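(* Given any odd integer $n\geq 1$, there exist a finite nilpotent group $G$ and a conjugacy class $a^G$ of $G$ such that $a^G a^G=(a^2)^G$ and $|a^G|=n$.
   Context: For $a,g\in G$: $a^g=g^{-1}ag$; $a^G=\{a^g\mid g\in G\}$ is the conjugacy class of $a$ in $G$. For subsets $X,Y$ of $G$, $XY=\{xy\mid x\in X,\ y\in Y\}$. *)

theory Defs
  imports "HOL-Algebra.Generated_Groups"
begin

definition conj_elt :: "('a, 'b) monoid_scheme \<Rightarrow> 'a \<Rightarrow> 'a \<Rightarrow> 'a"
  where "conj_elt G a g = inv\<^bsub>G\<^esub> g \<otimes>\<^bsub>G\<^esub> a \<otimes>\<^bsub>G\<^esub> g"

definition conj_class :: "('a, 'b) monoid_scheme \<Rightarrow> 'a \<Rightarrow> 'a set"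
  where "conj_class G a = {conj_elt G a g | g. g \<in> carrier G}"

text \<open>
  The subgroup \<open>[H, K]\<close> generated by all commutators \<open>[h, k] = h\<^sup>-\<^sup>1 k\<^sup>-\<^sup>1 h k\<close>.
\<close>

definition commutator_subgroup :: "('a, 'b) monoid_scheme \<Rightarrow> 'a set \<Rightarrow> 'a set \<Rightarrow> 'a set"
  where "commutator_subgroup G H K =
    generate G {inv\<^bsub>G\<^esub> h \<otimes>\<^bsub>G\<^esub> inv\<^bsub>G\<^esub> k \<otimes>\<^bsub>G\<^esub> h \<otimes>\<^bsub>G\<^esub> k | h k. h \<in> H \<and> k \<in> K}"

text \<open>Indexed from 0, so that \<open>lower_central_series G i\<close> is usually written \<open>\<gamma>\<^sub>i\<^sub>+\<^sub>1(G)\<close>.\<close>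

primrec lower_central_series :: "('a, 'b) monoid_scheme \<Rightarrow> nat \<Rightarrow> 'a set"
  where
    "lower_central_series G 0 = carrier G"
  | "lower_central_series G (Suc i) =
       commutator_subgroup G (lower_central_series G i) (carrier G)"

text \<open>Like \<open>solvable\<close>, this does not itself assert that \<open>G\<close> is a group.\<close>

definition nilpotent :: "('a, 'b) monoid_scheme \<Rightarrow> bool"
  where "nilpotent G \<longleftrightarrow> (\<exists>c. lower_central_series G c = {\<one>\<^bsub>G\<^esub>})"

end

theory Submission
  imports Defs "HOL-Algebra.Multiplicative_Group" "HOL-Library.Nat_Bijection"
begin

text \<open>
  In a group whose commutators are all central, fix an element \<open>a\<close>. Then \<open>g \<mapsto> [a, g]\<close> is a
  homomorphism, so its image \<open>N\<close> is a central subgroup, and \<open>a\<^sup>g = a [a, g]\<close> makes the class of \<open>a\<close>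
  the coset \<open>a N\<close>. Hence \<open>a\<^sup>G a\<^sup>G = a\<^sup>2 N\<close>, whereas \<open>(a\<^sup>2)\<^sup>g = (a\<^sup>g)\<^sup>2 = a\<^sup>2 [a, g]\<^sup>2\<close>, so
  \<open>(a\<^sup>2)\<^sup>G\<close> is \<open>a\<^sup>2\<close> times the set of squares of elements of \<open>N\<close>. If \<open>|N| = |a\<^sup>G|\<close> is odd, every
  element of \<open>N\<close> is a square in \<open>N\<close>, and the two sets coincide (\<open>conj_class_mult_self\<close>). Such a
  group is nilpotent of class at most two (\<open>nilpotent_if_commutators_central\<close>).

  It remains to find, for each odd \<open>n\<close>, a finite group of this kind that has a class of size \<open>n\<close>.
  The Heisenberg group over the integers modulo \<open>n\<close> has one: its elements are triples \<open>(x, y, z)\<close>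
  with product \<open>(x, y, z) (x', y', z') = (x + x', y + y', z + z' + x y')\<close>, the commutators are among
  the central elements \<open>(0, 0, z)\<close>, and the class of \<open>(1, 0, 0)\<close> consists of all \<open>(1, 0, z)\<close>.
\<close>

section \<open>Groups in which all commutators are central\<close>

definition commutator :: "('a, 'b) monoid_scheme \<Rightarrow> 'a \<Rightarrow> 'a \<Rightarrow> 'a"
  where "commutator G h k = inv\<^bsub>G\<^esub> h \<otimes>\<^bsub>G\<^esub> inv\<^bsub>G\<^esub> k \<otimes>\<^bsub>G\<^esub> h \<otimes>\<^bsub>G\<^esub> k"

locale central_commutator_group = group +
  assumes commutator_central:
    "\<lbrakk>x \<in> carrier G; y \<in> carrier G; z \<in> carrier G\<rbrakk>
      \<Longrightarrow> commutator G x y \<otimes> z = z \<otimes> commutator G x y"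

context group
begin

lemma commutator_closed [simp]:
  "\<lbrakk>x \<in> carrier G; y \<in> carrier G\<rbrakk> \<Longrightarrow> commutator G x y \<in> carrier G"
  by (simp add: commutator_def)

lemma conj_elt_closed [simp]:
  "\<lbrakk>x \<in> carrier G; y \<in> carrier G\<rbrakk> \<Longrightarrow> conj_elt G x y \<in> carrier G"
  by (simp add: conj_elt_def)

lemma mult_conj_elt:
  assumes "a \<in> carrier G" "g \<in> carrier G"
  shows "g \<otimes> conj_elt G a g = a \<otimes> g"
  using assms by (simp add: conj_elt_def flip: m_assoc)

text \<open>
  This form avoids inverses, so that in a concrete group conjugates can be found from the
  multiplication alone.
\<close>

lemma conj_elt_eq_iff:
  assumes "a \<in> carrier G" "g \<in> carrier G" "b \<in> carrier G"
  shows "conj_elt G a g = b \<longleftrightarrow> g \<otimes> b = a \<otimes> g"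
  using assms mult_conj_elt[of a g] Units_eq Units_l_cancel by (metis conj_elt_closed)

lemma conj_elt_eq_mult_commutator:
  assumes "a \<in> carrier G" "g \<in> carrier G"
  shows "conj_elt G a g = a \<otimes> commutator G a g"
  using assms by (simp add: conj_elt_def commutator_def flip: m_assoc)

lemma conj_elt_mult_left:
  assumes "a \<in> carrier G" "b \<in> carrier G" "g \<in> carrier G"
  shows "conj_elt G (a \<otimes> b) g = conj_elt G a g \<otimes> conj_elt G b g"
proof (subst conj_elt_eq_iff)
  have "g \<otimes> (conj_elt G a g \<otimes> conj_elt G b g) = (g \<otimes> conj_elt G a g) \<otimes> conj_elt G b g"
    using assms by (simp add: m_assoc)
  then show "g \<otimes> (conj_elt G a g \<otimes> conj_elt G b g) = a \<otimes> b \<otimes> g"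
    using assms by (simp add: mult_conj_elt m_assoc)
qed (use assms in simp_all)

lemma conj_elt_mult_right:
  assumes "a \<in> carrier G" "g \<in> carrier G" "h \<in> carrier G"
  shows "conj_elt G a (g \<otimes> h) = conj_elt G (conj_elt G a g) h"
  using assms by (simp add: conj_elt_def inv_mult_group m_assoc)

lemma commutator_eq_one_if_commute:
  assumes "x \<in> carrier G" "y \<in> carrier G" "x \<otimes> y = y \<otimes> x"
  shows "commutator G x y = \<one>"
proof -
  have "conj_elt G x y = x"
    using assms by (simp add: conj_elt_eq_iff)
  then show ?thesis
    using assms by (simp add: conj_elt_eq_mult_commutator)
qed

end

context central_commutator_group
begin

text \<open>
  The second term of the lower central series is generated by central elements, hence central;
  so the generators of the third term are trivial.
\<close>

lemma nilpotent_if_commutators_central: "nilpotent G"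
proof -
  have closed: "x \<in> carrier G" if "x \<in> lower_central_series G 1" for x
  proof -
    have "lower_central_series G 1 \<subseteq> carrier G"
      unfolding lower_central_series.simps commutator_subgroup_def One_nat_def
      by (rule generate_incl) (auto intro!: m_closed)
    then show ?thesis using that by blast
  qed
  have comm: "x \<otimes> z = z \<otimes> x" if "x \<in> lower_central_series G 1" and z: "z \<in> carrier G" for x z
  proof -
    let ?S = "{commutator G h k | h k. h \<in> carrier G \<and> k \<in> carrier G}"
    have "x \<in> generate G ?S"
      using that(1) by (simp add: commutator_subgroup_def commutator_def)
    moreover have "?S \<subseteq> carrier G"
      by auto
    ultimately show ?thesis
    proof (induction rule: generate.induct)
      case one
      then show ?case using z by simp
    next
      case (incl h)
      then show ?case using z by (auto simp: commutator_central)
    next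
      case (inv h)
      then have h: "h \<in> carrier G" "h \<otimes> z = z \<otimes> h"
        using z by (auto simp: commutator_central)
      have "z \<otimes> inv h = inv h \<otimes> h \<otimes> z \<otimes> inv h"
        using z h by simp
      also have "\<dots> = inv h \<otimes> (h \<otimes> z) \<otimes> inv h"
        using z h(1) by (simp only: m_assoc inv_closed m_closed)
      also have "\<dots> = inv h \<otimes> z"
        unfolding h(2) using z h(1) by (simp add: m_assoc)
      finally show ?case by simp
    next
      case (eng h1 h2)
      then have "h1 \<in> carrier G" "h2 \<in> carrier G"
        using generate_incl[of ?S] by auto
      with eng z show ?case by (metis m_assoc)
    qed
  qed
  define T where "T = {commutator G h k | h k. h \<in> lower_central_series G 1 \<and> k \<in> carrier G}"
  have "T \<subseteq> {\<one>}"
    unfolding T_def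
  proof clarify
    fix h k assume "h \<in> lower_central_series G 1" "k \<in> carrier G"
    then show "commutator G h k = \<one>"
      using closed comm by (intro commutator_eq_one_if_commute) blast+
  qed
  moreover have "\<one> \<in> lower_central_series G 1"
    by (simp add: commutator_subgroup_def generate.one)
  then have "T \<noteq> {}"
    unfolding T_def by blast
  ultimately have "T = {\<one>}"
    by (metis subset_singletonD)
  then have "lower_central_series G (Suc 1) = generate G {\<one>}"
    by (simp only: T_def lower_central_series.simps(2)[of G 1] commutator_subgroup_def commutator_def)
  then show ?thesis
    unfolding nilpotent_def using generate_one by metis
qed

text \<open>
  In any group \<open>[a, g h] = [a, h] [a, g]\<^sup>h\<close>, because conjugating \<open>a\<close> by \<open>g h\<close> is
  conjugating \<open>a\<^sup>g\<close> by \<open>h\<close>; and conjugation fixes the central commutator \<open>[a, g]\<close>.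
\<close>

lemma commutator_hom:
  assumes a: "a \<in> carrier G"
  shows "commutator G a \<in> hom G G"
proof (rule homI)
  fix g h assume gh: "g \<in> carrier G" "h \<in> carrier G"
  let ?c = "commutator G a"
  have "conj_elt G (?c g) h = ?c g"
    using a gh by (simp add: conj_elt_eq_iff commutator_central[of a g h])
  then have "a \<otimes> ?c (g \<otimes> h) = a \<otimes> ?c h \<otimes> ?c g"
    using a gh
    by (metis commutator_closed conj_elt_eq_mult_commutator conj_elt_mult_left
        conj_elt_mult_right m_closed)
  then have "?c (g \<otimes> h) = ?c h \<otimes> ?c g"
    using a gh by (simp add: m_assoc)
  also have "\<dots> = ?c g \<otimes> ?c h"
    using a gh by (intro commutator_central) simp_all
  finally show "?c (g \<otimes> h) = ?c g \<otimes> ?c h" .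
qed (use a in simp)

text \<open>
  Raising to the power \<open>(|N| + 1) / 2\<close> takes square roots in \<open>N\<close>, the image of \<open>g \<mapsto> [a, g]\<close>; this
  is where odd order enters.
\<close>

lemma commutator_is_square_of_commutator:
  assumes a: "a \<in> carrier G" and g: "g \<in> carrier G"
    and odd: "odd (card (conj_class G a))"
  obtains h where "h \<in> carrier G" "commutator G a h \<otimes> commutator G a h = commutator G a g"
proof -
  let ?c = "commutator G a"
  interpret c: group_hom G G ?c
    using commutator_hom[OF a] by unfold_locales
  let ?N = "?c ` carrier G"
  have N: "subgroup ?N G"
    by (rule c.img_is_subgroup)
  have "conj_class G a = (\<otimes>) a ` ?N"
    using a by (simp add: conj_class_def Setcompr_eq_image image_image conj_elt_eq_mult_commutator
        cong: image_cong_simp)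
  moreover have "inj_on ((\<otimes>) a) ?N"
    using a by (auto simp: inj_on_def)
  ultimately have card: "card (conj_class G a) = card ?N"
    by (simp add: card_image)
  interpret N: group "G\<lparr>carrier := ?N\<rparr>"
    using N by (rule subgroup_imp_group)
  have "?c g [^]\<^bsub>G\<lparr>carrier := ?N\<rparr>\<^esub> order (G\<lparr>carrier := ?N\<rparr>) = \<one>\<^bsub>G\<lparr>carrier := ?N\<rparr>\<^esub>"
    using g by (intro N.pow_order_eq_1) simp
  then have one: "?c g [^] card (conj_class G a) = \<one>"
    by (simp add: order_def card nat_pow_consistent[symmetric])
  obtain m where "card (conj_class G a) = 2 * m + 1"
    using odd by (auto elim: oddE)
  then have "?c g [^] (m + 1) \<otimes> ?c g [^] (m + 1) = ?c g [^] card (conj_class G a) \<otimes> ?c g"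
    using a g by (simp only: nat_pow_mult commutator_closed flip: nat_pow_Suc) (simp add: mult_2)
  then show thesis
    using one a g that[of "g [^] (m + 1)"] by (simp add: c.hom_nat_pow del: nat_pow_Suc)
qed

lemma conj_class_mult_self:
  assumes a: "a \<in> carrier G" and odd: "odd (card (conj_class G a))"
  shows "conj_class G a <#> conj_class G a = conj_class G (a [^] (2::nat))"
proof -
  let ?c = "commutator G a"
  have sq: "a [^] (2::nat) = a \<otimes> a"
    using a by (simp add: numeral_2_eq_2)
  have prod: "conj_elt G a g \<otimes> conj_elt G a h = a \<otimes> a \<otimes> (?c g \<otimes> ?c h)"
    if "g \<in> carrier G" "h \<in> carrier G" for g h
  proof -
    have "a \<otimes> ?c g \<otimes> (a \<otimes> ?c h) = a \<otimes> (?c g \<otimes> a) \<otimes> ?c h"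
      using a that by (simp add: m_assoc)
    also have "\<dots> = a \<otimes> (a \<otimes> ?c g) \<otimes> ?c h"
      using a that by (simp only: commutator_central[of a g a])
    also have "\<dots> = a \<otimes> a \<otimes> (?c g \<otimes> ?c h)"
      using a that by (simp add: m_assoc)
    finally show ?thesis
      using a that by (simp add: conj_elt_eq_mult_commutator)
  qed
  show ?thesis
  proof (intro equalityI subsetI)
    fix x assume "x \<in> conj_class G a <#> conj_class G a"
    then obtain g h where gh: "g \<in> carrier G" "h \<in> carrier G"
      and x: "x = conj_elt G a g \<otimes> conj_elt G a h"
      by (auto simp: set_mult_def conj_class_def)
    have "?c g \<otimes> ?c h = ?c (g \<otimes> h)"
      using commutator_hom[OF a] gh by (simp add: hom_mult)
    moreover obtain k where "k \<in> carrier G" "?c k \<otimes> ?c k = ?c (g \<otimes> h)"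
      by (rule commutator_is_square_of_commutator[OF a m_closed[OF gh] odd])
    ultimately have "x = conj_elt G (a [^] (2::nat)) k" "k \<in> carrier G"
      using a gh x by (simp_all add: prod sq conj_elt_mult_left)
    then show "x \<in> conj_class G (a [^] (2::nat))"
      by (auto simp: conj_class_def)
  next
    fix x assume "x \<in> conj_class G (a [^] (2::nat))"
    then obtain g where "g \<in> carrier G" "x = conj_elt G a g \<otimes> conj_elt G a g"
      using a by (auto simp: conj_class_def sq conj_elt_mult_left)
    then show "x \<in> conj_class G a <#> conj_class G a"
      unfolding set_mult_def conj_class_def by blast
  qed
qed

end

section \<open>The Heisenberg group modulo \<open>n\<close>\<close>

definition triple :: "nat \<Rightarrow> nat \<Rightarrow> nat \<Rightarrow> nat"
  where "triple x y z = prod_encode (x, prod_encode (y, z))"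

text \<open>
  Triples of residues are coded by single numbers because the group sought has carrier type
  \<open>nat\<close>.
\<close>

definition heisenberg_mult :: "nat \<Rightarrow> nat \<Rightarrow> nat \<Rightarrow> nat"
  where "heisenberg_mult n u v =
    (let (x, w) = prod_decode u; (y, z) = prod_decode w;
         (x', w') = prod_decode v; (y', z') = prod_decode w'
     in triple ((x + x') mod n) ((y + y') mod n) ((z + z' + x * y') mod n))"

definition heisenberg :: "nat \<Rightarrow> nat monoid"
  where "heisenberg n =
    \<lparr>carrier = {triple x y z | x y z. x < n \<and> y < n \<and> z < n},
     mult = heisenberg_mult n, one = triple 0 0 0\<rparr>"

lemma triple_eq_iff [simp]: "triple x y z = triple x' y' z' \<longleftrightarrow> x = x' \<and> y = y' \<and> z = z'"
  by (simp add: triple_def prod_encode_eq)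

lemma heisenberg_mult_triple [simp]:
  "triple x y z \<otimes>\<^bsub>heisenberg n\<^esub> triple x' y' z' =
    triple ((x + x') mod n) ((y + y') mod n) ((z + z' + x * y') mod n)"
  by (simp add: heisenberg_def heisenberg_mult_def triple_def)

lemma triple_in_heisenberg [simp]:
  "triple x y z \<in> carrier (heisenberg n) \<longleftrightarrow> x < n \<and> y < n \<and> z < n"
  by (auto simp: heisenberg_def)

lemma in_heisenbergE:
  assumes "u \<in> carrier (heisenberg n)"
  obtains x y z where "u = triple x y z" "x < n" "y < n" "z < n"
  using assms by (auto simp: heisenberg_def)

lemma one_heisenberg [simp]: "\<one>\<^bsub>heisenberg n\<^esub> = triple 0 0 0"
  by (simp add: heisenberg_def)

lemma finite_heisenberg: "finite (carrier (heisenberg n))"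
proof -
  have "carrier (heisenberg n) = (\<lambda>(x, y, z). triple x y z) ` ({..<n} \<times> {..<n} \<times> {..<n})"
    by (force simp: heisenberg_def)
  then show ?thesis by simp
qed

lemma group_heisenberg:
  assumes n: "n > 0"
  shows "group (heisenberg n)"
proof (rule groupI)
  fix u v assume "u \<in> carrier (heisenberg n)" "v \<in> carrier (heisenberg n)"
  then show "u \<otimes>\<^bsub>heisenberg n\<^esub> v \<in> carrier (heisenberg n)"
    using n by (auto elim!: in_heisenbergE)
next
  fix u v w
  assume "u \<in> carrier (heisenberg n)" "v \<in> carrier (heisenberg n)" "w \<in> carrier (heisenberg n)"
  then show "u \<otimes>\<^bsub>heisenberg n\<^esub> v \<otimes>\<^bsub>heisenberg n\<^esub> w = u \<otimes>\<^bsub>heisenberg n\<^esub> (v \<otimes>\<^bsub>heisenberg n\<^esub> w)"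
  proof (elim in_heisenbergE, goal_cases)
    case (1 x y z x' y' z' x'' y'' z'')
    have add: "((i + j) mod n + k) mod n = (i + (j + k) mod n) mod n" for i j k
      by (simp add: mod_simps add.assoc)
    have "((z + z' + x * y') mod n + z'' + (x + x') mod n * y'') mod n =
        (z + z' + x * y' + z'' + (x + x') * y'') mod n"
      by (intro mod_add_cong mod_mult_cong) simp_all
    also have "\<dots> = (z + (z' + z'' + x' * y'') + x * (y' + y'')) mod n"
      by (simp add: algebra_simps)
    also have "\<dots> = (z + (z' + z'' + x' * y'') mod n + x * ((y' + y'') mod n)) mod n"
      by (intro mod_add_cong mod_mult_cong) simp_all
    finally show ?case
      by (simp only: 1 heisenberg_mult_triple add)
  qed
next
  fix u assume "u \<in> carrier (heisenberg n)"
  then show "\<exists>v \<in> carrier (heisenberg n). v \<otimes>\<^bsub>heisenberg n\<^esub> u = \<one>\<^bsub>heisenberg n\<^esub>"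
  proof (rule in_heisenbergE)
    fix x y z assume u: "u = triple x y z" "x < n" "y < n" "z < n"
    define neg where "neg k = (n - k mod n) mod n" for k
    have neg: "neg k < n" "(neg k + k) mod n = 0" for k
    proof -
      show "neg k < n" using n by (simp add: neg_def)
      have "(neg k + k) mod n = (n - k mod n + k mod n) mod n"
        unfolding neg_def by (simp add: mod_simps)
      also have "\<dots> = 0" using n by (simp add: less_imp_le)
      finally show "(neg k + k) mod n = 0" .
    qed
    then have "triple (neg x) (neg y) (neg (z + neg x * y)) \<otimes>\<^bsub>heisenberg n\<^esub> u = \<one>\<^bsub>heisenberg n\<^esub>"
      by (simp add: u add.assoc)
    then show ?thesis
      using neg(1) by (metis triple_in_heisenberg)
  qed
qed (use n in \<open>auto elim!: in_heisenbergE\<close>)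

text \<open>
  From \<open>h k = k h [h, k]\<close> and the additivity of the first two coordinates, these coordinates
  vanish on \<open>[h, k]\<close>; elements \<open>(0, 0, z)\<close> are central.
\<close>

lemma central_commutator_group_heisenberg:
  assumes n: "n > 0"
  shows "central_commutator_group (heisenberg n)"
proof -
  interpret group "heisenberg n"
    using n by (rule group_heisenberg)
  show ?thesis
  proof
    fix h k g
    assume hk: "h \<in> carrier (heisenberg n)" "k \<in> carrier (heisenberg n)"
      and g: "g \<in> carrier (heisenberg n)"
    let ?c = "commutator (heisenberg n) h k"
    have "?c \<in> carrier (heisenberg n)"
      using hk by simp
    then obtain x y z where c: "?c = triple x y z" "x < n" "y < n" "z < n"
      by (rule in_heisenbergE)
    have eq: "k \<otimes>\<^bsub>heisenberg n\<^esub> (h \<otimes>\<^bsub>heisenberg n\<^esub> ?c) = h \<otimes>\<^bsub>heisenberg n\<^esub> k"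
      using hk by (metis conj_elt_eq_mult_commutator mult_conj_elt)
    have zero: "i = 0" if "(p + (q + i)) mod n = (q + p) mod n" "i < n" for i p q
    proof -
      have "(p + q + i) mod n = (p + q) mod n"
        using that(1) by (simp add: ac_simps)
      then have "n dvd (p + q + i) - (p + q)"
        by (subst (asm) mod_eq_dvd_iff_nat) simp_all
      then show ?thesis
        using that(2) by (auto simp: dvd_def)
    qed
    obtain p q r where h: "h = triple p q r" using hk(1) by (rule in_heisenbergE)
    obtain p' q' r' where k: "k = triple p' q' r'" using hk(2) by (rule in_heisenbergE)
    have "x = 0" "y = 0"
      using eq zero[of p' p x] zero[of q' q y] c by (simp_all add: h k c mod_simps)
    then show "?c \<otimes>\<^bsub>heisenberg n\<^esub> g = g \<otimes>\<^bsub>heisenberg n\<^esub> ?c"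
      using g c(1) by (auto elim!: in_heisenbergE simp: add.commute)
  qed
qed

text \<open>
  Conjugation by \<open>(x, y, z)\<close> takes \<open>(1, 0, 0)\<close> to \<open>(1, 0, y)\<close>. Reducing the entry \<open>1\<close> modulo \<open>n\<close>
  matters for \<open>n = 1\<close>, when the group is trivial.
\<close>

lemma card_conj_class_heisenberg:
  assumes n: "n > 0"
  shows "card (conj_class (heisenberg n) (triple (1 mod n) 0 0)) = n"
proof -
  interpret group "heisenberg n"
    using n by (rule group_heisenberg)
  let ?a = "triple (1 mod n) 0 0"
  have a: "?a \<in> carrier (heisenberg n)"
    using n by simp
  have conj: "conj_elt (heisenberg n) ?a (triple x y z) = triple (1 mod n) 0 y"
    if "x < n" "y < n" "z < n" for x y z
    using that n a
    by (subst conj_elt_eq_iff) (simp_all add: mod_simps add.commute)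
  have "conj_class (heisenberg n) ?a = triple (1 mod n) 0 ` {..<n}"
  proof (intro equalityI subsetI)
    fix u assume "u \<in> conj_class (heisenberg n) ?a"
    then obtain x y z where "u = conj_elt (heisenberg n) ?a (triple x y z)" "x < n" "y < n" "z < n"
      by (auto simp: conj_class_def elim: in_heisenbergE)
    then show "u \<in> triple (1 mod n) 0 ` {..<n}"
      using conj by blast
  next
    fix u assume "u \<in> triple (1 mod n) 0 ` {..<n}"
    then obtain y where "y < n" "u = conj_elt (heisenberg n) ?a (triple 0 y 0)"
      using conj n by auto
    moreover from this have "triple 0 y 0 \<in> carrier (heisenberg n)"
      using n by simp
    ultimately show "u \<in> conj_class (heisenberg n) ?a"
      by (auto simp: conj_class_def)
  qed
  then show ?thesis
    by (simp add: card_image inj_on_def)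
qed

theorem proposition4p4:
  fixes n :: nat
  assumes "odd n" and "n \<ge> 1"
  shows "\<exists>(G :: nat monoid) a.
           group G \<and> finite (carrier G) \<and> nilpotent G \<and> a \<in> carrier G \<and>
           conj_class G a <#>\<^bsub>G\<^esub> conj_class G a = conj_class G (a [^]\<^bsub>G\<^esub> (2::nat)) \<and>
           card (conj_class G a) = n"
proof -
  have n: "n > 0"
    using assms by simp
  interpret central_commutator_group "heisenberg n"
    using n by (rule central_commutator_group_heisenberg)
  let ?a = "triple (1 mod n) 0 0"
  have a: "?a \<in> carrier (heisenberg n)"
    using n by simp
  have card: "card (conj_class (heisenberg n) ?a) = n"
    using n by (rule card_conj_class_heisenberg)
  then have "conj_class (heisenberg n) ?a <#>\<^bsub>heisenberg n\<^esub> conj_class (heisenberg n) ?a =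
      conj_class (heisenberg n) (?a [^]\<^bsub>heisenberg n\<^esub> (2::nat))"
    using a assms(1) by (intro conj_class_mult_self) simp_all
  then show ?thesis
    using card a finite_heisenberg nilpotent_if_commutators_central is_group by blast
qed

end
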